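(* Let $f:\omega\to\omega$ be a permutation such that the map $\pi$ defined by $\pi([A]_{\mathrm T})=[f^*(A)]_{\mathrm T}$ for $A\in 2^\omega$ is an automorphism of the Turing degrees. Then $f$ is recursive.
   Context: For $f:\omega\to\omega$, the pullback $f^*$ is given by $f^*(A)(n)=A(f(n))$ for $A\in 2^\omega$ (subsets of $\omega$ identified with characteristic functions). An automorphism of the Turing degrees is a bijection of the set of Turing degrees of subsets of $\omega$ preserving and reflecting $\le_{\mathrm T}$; it is induced by $f$ if it is given by $[A]\mapsto[f^*(A)]$. *)

theory Defs
  imports Main
begin

text \<open>
  Kleene's \<open>\<mu>\<close>-recursive functions relative to an oracle function \<open>g :: nat \<Rightarrow> nat\<close>.
  Programs act on lists of arguments of any length; an application with too few arguments,
  or of a unary primitive to the wrong number of arguments, has no value.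
\<close>

datatype recf =
    Zero
  | Succ
  | Proj nat
  | Oracle
  | Comp recf "recf list"
  | PrimRec recf recf
  | Mu recf

text \<open>
  \<open>rec_eval g p xs y\<close> says that \<open>p\<close> with oracle \<open>g\<close> halts on \<open>xs\<close> with
  value \<open>y\<close>. In the rule for \<open>Mu p\<close>, the values of \<open>p\<close> below the zero found must
  all be defined and nonzero.
\<close>

inductive rec_eval :: "(nat \<Rightarrow> nat) \<Rightarrow> recf \<Rightarrow> nat list \<Rightarrow> nat \<Rightarrow> bool" for g where
  rec_eval_Zero: "rec_eval g Zero xs 0"
| rec_eval_Succ: "rec_eval g Succ [x] (Suc x)"
| rec_eval_Proj: "i < length xs \<Longrightarrow> rec_eval g (Proj i) xs (xs ! i)"
| rec_eval_Oracle: "rec_eval g Oracle [x] (g x)"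
| rec_eval_Comp: "list_all2 (\<lambda>q y. rec_eval g q xs y) qs ys \<Longrightarrow> rec_eval g p ys z \<Longrightarrow> rec_eval g (Comp p qs) xs z"
| rec_eval_PrimRec_0: "rec_eval g p xs y \<Longrightarrow> rec_eval g (PrimRec p q) (0 # xs) y"
| rec_eval_PrimRec_Suc: "rec_eval g (PrimRec p q) (n # xs) r \<Longrightarrow> rec_eval g q (n # r # xs) y \<Longrightarrow>
    rec_eval g (PrimRec p q) (Suc n # xs) y"
| rec_eval_Mu: "rec_eval g p (y # xs) 0 \<Longrightarrow> (\<And>z. z < y \<Longrightarrow> \<exists>w. rec_eval g p (z # xs) (Suc w)) \<Longrightarrow>
    rec_eval g (Mu p) xs y"

primrec oracle_free :: "recf \<Rightarrow> bool" where
  "oracle_free Zero \<longleftrightarrow> True"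
| "oracle_free Succ \<longleftrightarrow> True"
| "oracle_free (Proj i) \<longleftrightarrow> True"
| "oracle_free Oracle \<longleftrightarrow> False"
| "oracle_free (Comp p qs) \<longleftrightarrow> oracle_free p \<and> list_all (\<lambda>b. b) (map oracle_free qs)"
| "oracle_free (PrimRec p q) \<longleftrightarrow> oracle_free p \<and> oracle_free q"
| "oracle_free (Mu p) \<longleftrightarrow> oracle_free p"

definition recursive_in :: "(nat \<Rightarrow> nat) \<Rightarrow> (nat \<Rightarrow> nat) \<Rightarrow> bool" where
  "recursive_in g f \<longleftrightarrow> (\<exists>p. \<forall>n. rec_eval g p [n] (f n))"

text \<open>The oracle supplied to an oracle-free program is irrelevant.\<close>

definition recursive :: "(nat \<Rightarrow> nat) \<Rightarrow> bool" where
  "recursive f \<longleftrightarrow> (\<exists>p. oracle_free p \<and> (\<forall>n. rec_eval (\<lambda>_. 0) p [n] (f n)))"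

type_synonym cantor = "nat \<Rightarrow> bool"

definition turing_le :: "cantor \<Rightarrow> cantor \<Rightarrow> bool" (infix "\<le>\<^sub>T" 50) where
  "A \<le>\<^sub>T B \<longleftrightarrow> recursive_in (\<lambda>n. of_bool (B n)) (\<lambda>n. of_bool (A n))"

definition turing_equiv :: "cantor \<Rightarrow> cantor \<Rightarrow> bool" (infix "\<equiv>\<^sub>T" 50) where
  "A \<equiv>\<^sub>T B \<longleftrightarrow> A \<le>\<^sub>T B \<and> B \<le>\<^sub>T A"

primrec subst_oracle :: "recf \<Rightarrow> recf \<Rightarrow> recf" where
  "subst_oracle r Zero = Zero"
| "subst_oracle r Succ = Succ"
| "subst_oracle r (Proj i) = Proj i"
| "subst_oracle r Oracle = r"
| "subst_oracle r (Comp p qs) = Comp (subst_oracle r p) (map (subst_oracle r) qs)"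
| "subst_oracle r (PrimRec p q) = PrimRec (subst_oracle r p) (subst_oracle r q)"
| "subst_oracle r (Mu p) = Mu (subst_oracle r p)"

lemma rec_eval_subst_oracle:
  assumes "\<And>n. rec_eval g r [n] (f n)" and "rec_eval f p xs y"
  shows "rec_eval g (subst_oracle r p) xs y"
  using assms(2)
proof (induction rule: rec_eval.induct)
  case (rec_eval_Comp xs qs ys p z)
  have "list_all2 (\<lambda>q y. rec_eval g q xs y) (map (subst_oracle r) qs) ys"
    using rec_eval_Comp.IH(1) rec_eval_Comp.hyps(1)
    by (auto simp: list_all2_conv_all_nth)
  with rec_eval_Comp.IH show ?case
    by (auto intro: rec_eval.rec_eval_Comp)
next
  case (rec_eval_Mu p y xs)
  then show ?case
    by (auto intro!: rec_eval.rec_eval_Mu)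
qed (auto intro: rec_eval.intros assms(1))

lemma rec_eval_det: "rec_eval g p xs y \<Longrightarrow> rec_eval g p xs y' \<Longrightarrow> y = y'"
proof (induction arbitrary: y' rule: rec_eval.induct)
  case (rec_eval_Comp xs qs ys p z)
  from rec_eval_Comp.prems obtain ys' where
    "list_all2 (\<lambda>q y. rec_eval g q xs y) qs ys'" and z: "rec_eval g p ys' y'"
    by (auto elim: rec_eval.cases)
  with rec_eval_Comp.IH(1) have "ys = ys'"
    by (auto simp: list_all2_conv_all_nth intro!: nth_equalityI)
  with z rec_eval_Comp.IH(2) show ?case by simp
next
  case (rec_eval_Mu p y xs)
  from rec_eval_Mu.prems have y': "rec_eval g p (y' # xs) 0"
    "\<And>z. z < y' \<Longrightarrow> \<exists>w. rec_eval g p (z # xs) (Suc w)"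
    by (auto elim: rec_eval.cases)
  show ?case
  proof (cases y y' rule: linorder_cases)
    case less
    with y'(2) rec_eval_Mu.IH(1) show ?thesis by blast
  next
    case greater
    with y'(1) rec_eval_Mu.IH(2) show ?thesis by blast
  qed
next
  case (rec_eval_PrimRec_0 p xs y q)
  from rec_eval_PrimRec_0.prems have "rec_eval g p xs y'" by (auto elim: rec_eval.cases)
  then show ?case by (rule rec_eval_PrimRec_0.IH)
next
  case (rec_eval_PrimRec_Suc p q n xs r y)
  from rec_eval_PrimRec_Suc.prems obtain r' where
    "rec_eval g (PrimRec p q) (n # xs) r'" "rec_eval g q (n # r' # xs) y'"
    by (auto elim: rec_eval.cases)
  with rec_eval_PrimRec_Suc.IH show ?case by metis
qed (auto elim: rec_eval.cases)

lemma recursive_in_refl: "recursive_in g g"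
  unfolding recursive_in_def using rec_eval_Oracle by blast

lemma recursive_in_trans: "recursive_in g f \<Longrightarrow> recursive_in f h \<Longrightarrow> recursive_in g h"
  unfolding recursive_in_def by (meson rec_eval_subst_oracle)

lemma turing_le_refl: "A \<le>\<^sub>T A"
  unfolding turing_le_def by (rule recursive_in_refl)

lemma turing_le_trans: "A \<le>\<^sub>T B \<Longrightarrow> B \<le>\<^sub>T C \<Longrightarrow> A \<le>\<^sub>T C"
  unfolding turing_le_def by (rule recursive_in_trans)

lemma oracle_free_subst_Zero: "oracle_free (subst_oracle Zero p)"
  by (induction p) (auto simp: list_all_iff)

lemma recursive_iff_recursive_in_zero: "recursive f \<longleftrightarrow> recursive_in (\<lambda>_. 0) f"
proof
  assume "recursive_in (\<lambda>_. 0) f"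
  then obtain p where "\<And>n. rec_eval (\<lambda>_. 0) p [n] (f n)"
    unfolding recursive_in_def by blast
  then have "\<And>n. rec_eval (\<lambda>_. 0) (subst_oracle Zero p) [n] (f n)"
    by (intro rec_eval_subst_oracle[where f = "\<lambda>_. 0"] rec_eval_Zero)
  then show "recursive f"
    unfolding recursive_def using oracle_free_subst_Zero by blast
qed (auto simp: recursive_def recursive_in_def)

quotient_type turing_degree = cantor / turing_equiv
  morphisms rep_turing_degree deg
  by (rule equivpI)
    (auto simp: turing_equiv_def intro!: reflpI sympI transpI intro: turing_le_refl turing_le_trans)

instantiation turing_degree :: order
begin

lift_definition less_eq_turing_degree :: "turing_degree \<Rightarrow> turing_degree \<Rightarrow> bool" is turing_le
  by (auto simp: turing_equiv_def intro: turing_le_trans)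

definition less_turing_degree :: "turing_degree \<Rightarrow> turing_degree \<Rightarrow> bool" where
  "less_turing_degree a b \<longleftrightarrow> a \<le> b \<and> \<not> b \<le> a"

instance
proof
  fix a b c :: turing_degree
  show "a < b \<longleftrightarrow> a \<le> b \<and> \<not> b \<le> a" by (rule less_turing_degree_def)
  show "a \<le> a" by transfer (rule turing_le_refl)
  show "a \<le> b \<Longrightarrow> b \<le> c \<Longrightarrow> a \<le> c" by transfer (rule turing_le_trans)
  show "a \<le> b \<Longrightarrow> b \<le> a \<Longrightarrow> a = b" by transfer (simp add: turing_equiv_def)
qed

end

definition degree_automorphism :: "(turing_degree \<Rightarrow> turing_degree) \<Rightarrow> bool" where
  "degree_automorphism \<pi> \<longleftrightarrow> bij \<pi> \<and> (\<forall>a b. a \<le> b \<longleftrightarrow> \<pi> a \<le> \<pi> b)"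

definition pullback :: "(nat \<Rightarrow> nat) \<Rightarrow> cantor \<Rightarrow> cantor" where
  "pullback f A = (\<lambda>n. A (f n))"

end

theory Submission
  imports Defs "HOL-Analysis.Urysohn"
begin

text \<open>
  Put \<open>h = f\<^sup>-\<^sup>1 \<circ> Suc \<circ> f\<close>.  Every \<open>B\<close> computes \<open>B \<circ> Suc\<close>, so the induced automorphism, applied
  to \<open>B = A \<circ> f\<^sup>-\<^sup>1\<close>, shows that every \<open>A\<close> computes \<open>A \<circ> h\<close>.  By Baire category one program \<open>p\<close>
  does this for a dense set of \<open>A\<close> in some cylinder, which fixes the first \<open>l\<close> values of \<open>A\<close>.
  Then \<open>h\<close> is recursive: if \<open>p\<close> gives different answers at \<open>n\<close> for two finite oracles in that
  cylinder which differ only at the position \<open>m\<close>, density forces \<open>m = h n\<close>, and such a pair can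
  be searched for unless \<open>h n < l\<close>.  Whether \<open>h n = i\<close>, for one of the finitely many \<open>i < l\<close>, is
  decidable because the recursive set \<open>{i}\<close> computes its pullback.  Since \<open>f\<^sup>-\<^sup>1 n = h\<^sup>n (f\<^sup>-\<^sup>1 0)\<close>,
  the inverse of \<open>f\<close> is recursive, and so is \<open>f\<close>.
\<close>

section \<open>Computable functions of several arguments\<close>

abbreviation characteristic :: "cantor \<Rightarrow> nat \<Rightarrow> nat" where
  "characteristic A \<equiv> \<lambda>n. of_bool (A n)"

definition computable_in :: "(nat \<Rightarrow> nat) \<Rightarrow> nat \<Rightarrow> (nat list \<Rightarrow> nat) \<Rightarrow> bool" where
  "computable_in g k F \<longleftrightarrow> (\<exists>p. \<forall>xs. length xs = k \<longrightarrow> rec_eval g p xs (F xs))"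

definition decidable_in :: "(nat \<Rightarrow> nat) \<Rightarrow> nat \<Rightarrow> (nat list \<Rightarrow> bool) \<Rightarrow> bool" where
  "decidable_in g k P \<longleftrightarrow> computable_in g k (\<lambda>xs. of_bool (P xs))"

definition computable_tuple_in ::
    "(nat \<Rightarrow> nat) \<Rightarrow> nat \<Rightarrow> nat \<Rightarrow> (nat list \<Rightarrow> nat list) \<Rightarrow> bool" where
  "computable_tuple_in g k j H \<longleftrightarrow>
    (\<forall>xs. length xs = k \<longrightarrow> length (H xs) = j) \<and> (\<forall>i<j. computable_in g k (\<lambda>xs. H xs ! i))"

lemma recursive_in_iff_computable_in: "recursive_in g f \<longleftrightarrow> computable_in g 1 (\<lambda>xs. f (xs ! 0))"
  unfolding recursive_in_def computable_in_def
  by (metis One_nat_def length_Cons length_0_conv length_Suc_conv nth_Cons_0)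

lemma recursive_iff_computable_in: "recursive f \<longleftrightarrow> computable_in (\<lambda>_. 0) 1 (\<lambda>xs. f (xs ! 0))"
  unfolding recursive_iff_recursive_in_zero by (rule recursive_in_iff_computable_in)

lemma turing_le_iff_decidable_in:
  "A \<le>\<^sub>T B \<longleftrightarrow> decidable_in (characteristic B) 1 (\<lambda>xs. A (xs ! 0))"
  unfolding turing_le_def decidable_in_def by (rule recursive_in_iff_computable_in)

lemma computable_in_if_computable_in_zero:
  assumes "computable_in (\<lambda>_. 0) k F"
  shows "computable_in g k F"
  using assms rec_eval_subst_oracle[where f = "\<lambda>_. 0", OF rec_eval_Zero]
  unfolding computable_in_def by blast

lemma computable_cong:
  "(\<And>xs. length xs = k \<Longrightarrow> F xs = G xs) \<Longrightarrow> computable_in g k F \<longleftrightarrow> computable_in g k G"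
  unfolding computable_in_def by metis

lemma computable_nth: "i < k \<Longrightarrow> computable_in g k (\<lambda>xs. xs ! i)"
  unfolding computable_in_def using rec_eval_Proj by blast

lemma computable_compose:
  assumes F: "computable_in g j F" and H: "computable_tuple_in g k j H"
  shows "computable_in g k (\<lambda>xs. F (H xs))"
proof -
  from F obtain p where p: "\<And>ys. length ys = j \<Longrightarrow> rec_eval g p ys (F ys)"
    unfolding computable_in_def by blast
  from H obtain q where q: "\<And>i xs. i < j \<Longrightarrow> length xs = k \<Longrightarrow> rec_eval g (q i) xs (H xs ! i)"
    unfolding computable_tuple_in_def computable_in_def by metis
  have length_H: "length (H xs) = j" if "length xs = k" for xs
    using H that by (simp add: computable_tuple_in_def)
  have "rec_eval g (Comp p (map q [0..<j])) xs (F (H xs))" if "length xs = k" for xs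
    by (rule rec_eval_Comp[where ys = "H xs"])
      (use that p q length_H in \<open>auto simp: list_all2_conv_all_nth\<close>)
  then show ?thesis
    unfolding computable_in_def by blast
qed

lemma computable_tuple_nth:
  "computable_tuple_in g k j H \<Longrightarrow> i < j \<Longrightarrow> computable_in g k (\<lambda>xs. H xs ! i)"
  by (simp add: computable_tuple_in_def)

lemma computable_tuple_id: "computable_tuple_in g k k (\<lambda>xs. xs)"
  by (simp add: computable_tuple_in_def computable_nth)

lemma computable_tuple_Nil: "computable_tuple_in g k 0 (\<lambda>xs. [])"
  by (simp add: computable_tuple_in_def)

lemma computable_tuple_Cons:
  "computable_in g k F \<Longrightarrow> computable_tuple_in g k j H \<Longrightarrow>
    computable_tuple_in g k (Suc j) (\<lambda>xs. F xs # H xs)"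
  by (auto simp: computable_tuple_in_def less_Suc_eq_0_disj)

lemma computable_tuple_tl:
  assumes "computable_tuple_in g k j H"
  shows "computable_tuple_in g k (j - 1) (\<lambda>xs. tl (H xs))"
proof -
  have "computable_in g k (\<lambda>xs. tl (H xs) ! i) \<longleftrightarrow> computable_in g k (\<lambda>xs. H xs ! Suc i)"
    if "i < j - 1" for i
    using assms that by (intro computable_cong) (simp add: computable_tuple_in_def nth_tl)
  then show ?thesis
    using assms by (simp add: computable_tuple_in_def)
qed

lemma computable_tuple_map:
  assumes "\<And>q. q \<in> set qs \<Longrightarrow> computable_in g k (F q)"
  shows "computable_tuple_in g k (length qs) (\<lambda>xs. map (\<lambda>q. F q xs) qs)"
  using assms by (simp add: computable_tuple_in_def)

lemma computable_tuple_compose: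
  assumes H: "computable_tuple_in g m j H" and K: "computable_tuple_in g k m K"
  shows "computable_tuple_in g k j (\<lambda>xs. H (K xs))"
  using H K computable_compose[OF _ K, of "\<lambda>ys. H ys ! _"] by (simp add: computable_tuple_in_def)

lemma computable_tuple_tl_id: "computable_tuple_in g (Suc k) k tl"
  using computable_tuple_tl[OF computable_tuple_id, of g "Suc k"] by simp

lemma computable_comp_tl: "computable_in g k F \<Longrightarrow> computable_in g (Suc k) (\<lambda>xs. F (tl xs))"
  by (rule computable_compose[OF _ computable_tuple_tl_id])

lemma computable_tuple_comp_tl:
  "computable_tuple_in g k j H \<Longrightarrow> computable_tuple_in g (Suc k) j (\<lambda>xs. H (tl xs))"
  by (rule computable_tuple_compose[OF _ computable_tuple_tl_id])

lemma computable_compose1: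
  assumes "computable_in g 1 (\<lambda>xs. h (xs ! 0))" "computable_in g k F"
  shows "computable_in g k (\<lambda>xs. h (F xs))"
  using computable_compose[OF assms(1), of k "\<lambda>xs. [F xs]"] assms(2)
  by (simp add: computable_tuple_Cons computable_tuple_Nil)

lemma computable_Suc: "computable_in g k F \<Longrightarrow> computable_in g k (\<lambda>xs. Suc (F xs))"
proof (erule computable_compose1[rotated])
  show "computable_in g 1 (\<lambda>xs. Suc (xs ! 0))"
    unfolding computable_in_def
    by (rule exI[of _ Succ]) (auto simp: length_Suc_conv intro: rec_eval_Succ)
qed

lemma computable_oracle: "computable_in g k F \<Longrightarrow> computable_in g k (\<lambda>xs. g (F xs))"
  using recursive_in_refl unfolding recursive_in_iff_computable_in by (rule computable_compose1)

lemma computable_const: "computable_in g k (\<lambda>xs. c)"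
proof (induction c)
  case 0
  show ?case unfolding computable_in_def using rec_eval_Zero by blast
qed (rule computable_Suc)

lemma computable_rec_nat:
  assumes F: "computable_in g k F"
    and G: "computable_in g (Suc (Suc k)) (\<lambda>ys. G (ys ! 0) (ys ! 1) (tl (tl ys)))"
    and N: "computable_in g k N"
  shows "computable_in g k (\<lambda>xs. rec_nat (F xs) (\<lambda>n r. G n r xs) (N xs))"
proof -
  from F obtain p where p: "\<And>xs. length xs = k \<Longrightarrow> rec_eval g p xs (F xs)"
    unfolding computable_in_def by blast
  from G obtain q where q: "\<And>ys. length ys = Suc (Suc k) \<Longrightarrow>
      rec_eval g q ys (G (ys ! 0) (ys ! 1) (tl (tl ys)))"
    unfolding computable_in_def by blast
  have "rec_eval g (PrimRec p q) (n # xs) (rec_nat (F xs) (\<lambda>n r. G n r xs) n)"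
    if xs: "length xs = k" for n xs
  proof (induction n)
    case 0
    show ?case using p[OF xs] by (simp add: rec_eval_PrimRec_0)
  next
    case (Suc n)
    with q[of "n # _ # xs"] xs show ?case by (auto intro: rec_eval_PrimRec_Suc)
  qed
  then have "computable_in g (Suc k) (\<lambda>ys. rec_nat (F (tl ys)) (\<lambda>n r. G n r (tl ys)) (ys ! 0))"
    unfolding computable_in_def by (intro exI[of _ "PrimRec p q"]) (auto simp: length_Suc_conv)
  from computable_compose[OF this computable_tuple_Cons[OF N computable_tuple_id]]
  show ?thesis by simp
qed

lemma computable_if:
  assumes "decidable_in g k P" "computable_in g k F" "computable_in g k G"
  shows "computable_in g k (\<lambda>xs. if P xs then F xs else G xs)"
proof -
  have "computable_in g k (\<lambda>xs. rec_nat (G xs) (\<lambda>_ _. F xs) (of_bool (P xs)))"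
    using assms by (intro computable_rec_nat computable_comp_tl) (simp_all add: decidable_in_def)
  also have "(\<lambda>xs. rec_nat (G xs) (\<lambda>_ _. F xs) (of_bool (P xs))) =
      (\<lambda>xs. if P xs then F xs else G xs)"
    by auto
  finally show ?thesis .
qed

lemma decidable_compose:
  "decidable_in g j P \<Longrightarrow> computable_tuple_in g k j H \<Longrightarrow> decidable_in g k (\<lambda>xs. P (H xs))"
  unfolding decidable_in_def by (rule computable_compose)

lemma decidable_compose1:
  "decidable_in g 1 (\<lambda>xs. P (xs ! 0)) \<Longrightarrow> computable_in g k F \<Longrightarrow> decidable_in g k (\<lambda>xs. P (F xs))"
  unfolding decidable_in_def by (rule computable_compose1)

lemma decidable_const: "decidable_in g k (\<lambda>xs. b)"
  unfolding decidable_in_def by (rule computable_const)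

lemma decidable_not:
  assumes "decidable_in g k P"
  shows "decidable_in g k (\<lambda>xs. \<not> P xs)"
proof -
  have "computable_in g k (\<lambda>xs. if P xs then 0 else 1)"
    using assms by (intro computable_if computable_const)
  also have "(\<lambda>xs. if P xs then 0 else 1 :: nat) = (\<lambda>xs. of_bool (\<not> P xs))"
    by auto
  finally show ?thesis by (simp only: decidable_in_def)
qed

lemma computable_Least:
  assumes P: "decidable_in g (Suc k) (\<lambda>ys. P (ys ! 0) (tl ys))"
    and ex: "\<And>xs. length xs = k \<Longrightarrow> \<exists>y. P y xs"
  shows "computable_in g k (\<lambda>xs. LEAST y. P y xs)"
proof -
  obtain p where p: "\<And>ys. length ys = Suc k \<Longrightarrow> rec_eval g p ys (of_bool (\<not> P (ys ! 0) (tl ys)))"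
    using decidable_not[OF P] unfolding decidable_in_def computable_in_def by blast
  have "rec_eval g (Mu p) xs (LEAST y. P y xs)" if xs: "length xs = k" for xs
  proof (rule rec_eval_Mu)
    have "P (LEAST y. P y xs) xs"
      using ex[OF xs] by (rule LeastI_ex)
    with p[of "(LEAST y. P y xs) # xs"] xs show "rec_eval g p ((LEAST y. P y xs) # xs) 0"
      by simp
  next
    fix z assume "z < (LEAST y. P y xs)"
    then have "\<not> P z xs" by (rule not_less_Least)
    with p[of "z # xs"] xs show "\<exists>w. rec_eval g p (z # xs) (Suc w)" by auto
  qed
  then show ?thesis unfolding computable_in_def by blast
qed

lemma decidable_conj:
  assumes "decidable_in g k P" "decidable_in g k Q"
  shows "decidable_in g k (\<lambda>xs. P xs \<and> Q xs)"
proof -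
  have "computable_in g k (\<lambda>xs. if P xs then of_bool (Q xs) else 0)"
    using assms by (intro computable_if computable_const) (simp_all add: decidable_in_def)
  also have "(\<lambda>xs. if P xs then of_bool (Q xs) else 0 :: nat) = (\<lambda>xs. of_bool (P xs \<and> Q xs))"
    by auto
  finally show ?thesis by (simp only: decidable_in_def)
qed

lemma decidable_disj:
  assumes "decidable_in g k P" "decidable_in g k Q"
  shows "decidable_in g k (\<lambda>xs. P xs \<or> Q xs)"
  using decidable_not[OF decidable_conj[OF assms[THEN decidable_not]]] by simp

lemma decidable_if:
  assumes "decidable_in g k P" "decidable_in g k Q" "decidable_in g k R"
  shows "decidable_in g k (\<lambda>xs. if P xs then Q xs else R xs)"
  using computable_if[OF assms(1) assms(2,3)[unfolded decidable_in_def]]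
  by (simp add: decidable_in_def if_distrib)

lemma decidable_bex_finite:
  assumes "finite A" and "\<And>a. a \<in> A \<Longrightarrow> decidable_in g k (P a)"
  shows "decidable_in g k (\<lambda>xs. \<exists>a\<in>A. P a xs)"
  using assms by (induction A rule: finite_induct) (simp_all add: decidable_const decidable_disj)

lemma decidable_bex_less:
  assumes "decidable_in g (Suc k) (\<lambda>ys. P (ys ! 0) (tl ys))" and "computable_in g k N"
  shows "decidable_in g k (\<lambda>xs. \<exists>i<N xs. P i xs)"
proof -
  have "decidable_in g (Suc (Suc k)) (\<lambda>ys. P (ys ! 0) (tl (tl ys)))"
    using decidable_compose[OF assms(1), of "Suc (Suc k)" "\<lambda>ys. ys ! 0 # tl (tl ys)"]
    by (simp add: computable_tuple_Cons computable_nth computable_tuple_comp_tl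
        computable_tuple_tl_id)
  then have "computable_in g k (\<lambda>xs. rec_nat 0 (\<lambda>i r. if P i xs then 1 else r) (N xs))"
    using assms(2)
    by (intro computable_rec_nat computable_if computable_const computable_nth) simp_all
  moreover have "rec_nat 0 (\<lambda>i r. if P i xs then 1 else r) n = (of_bool (\<exists>i<n. P i xs) :: nat)"
    for n xs
    by (induction n) (auto simp: less_Suc_eq)
  ultimately show ?thesis by (simp add: decidable_in_def)
qed

lemma computable_pred:
  assumes "computable_in g k F"
  shows "computable_in g k (\<lambda>xs. F xs - 1)"
proof -
  have "computable_in g k (\<lambda>xs. rec_nat 0 (\<lambda>n r. n) (F xs))"
    using assms by (intro computable_rec_nat computable_const computable_nth) simp_all
  moreover have "rec_nat 0 (\<lambda>n r. n) m = m - 1" for m :: nat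
    by (cases m) auto
  ultimately show ?thesis by simp
qed

lemma computable_diff:
  assumes "computable_in g k F" "computable_in g k G"
  shows "computable_in g k (\<lambda>xs. F xs - G xs)"
proof -
  have "computable_in g k (\<lambda>xs. rec_nat (F xs) (\<lambda>n r. r - 1) (G xs))"
    using assms by (intro computable_rec_nat computable_pred computable_nth) simp_all
  moreover have "rec_nat a (\<lambda>n r. r - 1) b = a - b" for a b :: nat
    by (induction b) auto
  ultimately show ?thesis by simp
qed

lemma computable_add:
  assumes "computable_in g k F" "computable_in g k G"
  shows "computable_in g k (\<lambda>xs. F xs + G xs)"
proof -
  have "computable_in g k (\<lambda>xs. rec_nat (F xs) (\<lambda>n r. Suc r) (G xs))"
    using assms by (intro computable_rec_nat computable_Suc computable_nth) simp_all
  moreover have "rec_nat a (\<lambda>n r. Suc r) b = a + b" for a b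
    by (induction b) auto
  ultimately show ?thesis by simp
qed

lemma computable_mult:
  assumes "computable_in g k F" "computable_in g k G"
  shows "computable_in g k (\<lambda>xs. F xs * G xs)"
proof -
  have "computable_in g k (\<lambda>xs. rec_nat 0 (\<lambda>n r. r + F xs) (G xs))"
    using assms
    by (intro computable_rec_nat computable_const computable_add computable_nth computable_comp_tl)
      simp_all
  moreover have "rec_nat 0 (\<lambda>n r. r + a) b = a * b" for a b :: nat
    by (induction b) auto
  ultimately show ?thesis by simp
qed

lemma computable_power:
  assumes "computable_in g k F" "computable_in g k G"
  shows "computable_in g k (\<lambda>xs. F xs ^ G xs)"
proof -
  have "computable_in g k (\<lambda>xs. rec_nat 1 (\<lambda>n r. F xs * r) (G xs))"
    using assms
    by (intro computable_rec_nat computable_const computable_mult computable_nth computable_comp_tl)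
      simp_all
  moreover have "rec_nat 1 (\<lambda>n r. a * r) b = a ^ b" for a b :: nat
    by (induction b) auto
  ultimately show ?thesis by simp
qed

lemma decidable_eq_0:
  assumes "computable_in g k F"
  shows "decidable_in g k (\<lambda>xs. F xs = 0)"
proof -
  have "computable_in g k (\<lambda>xs. 1 - F xs)"
    using assms by (intro computable_diff computable_const)
  also have "(\<lambda>xs. 1 - F xs) = (\<lambda>xs. of_bool (F xs = 0))"
    by auto
  finally show ?thesis by (simp only: decidable_in_def)
qed

lemma decidable_less:
  assumes "computable_in g k F" "computable_in g k G"
  shows "decidable_in g k (\<lambda>xs. F xs < G xs)"
  using decidable_not[OF decidable_eq_0[OF computable_diff[OF assms(2,1)]]] by (simp add: not_le)

lemma decidable_eq:
  assumes "computable_in g k F" "computable_in g k G"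
  shows "decidable_in g k (\<lambda>xs. F xs = G xs)"
proof -
  have "decidable_in g k (\<lambda>xs. \<not> F xs < G xs \<and> \<not> G xs < F xs)"
    using assms by (intro decidable_conj decidable_not decidable_less)
  then show ?thesis by (simp add: not_less eq_iff conj_commute)
qed

lemma computable_div:
  assumes "computable_in g k F" "computable_in g k G"
  shows "computable_in g k (\<lambda>xs. F xs div G xs)"
proof -
  have "computable_in g k (\<lambda>xs. LEAST q. G xs = 0 \<or> F xs < Suc q * G xs)"
  proof (rule computable_Least)
    show "decidable_in g (Suc k) (\<lambda>ys. G (tl ys) = 0 \<or> F (tl ys) < Suc (ys ! 0) * G (tl ys))"
      using assms[THEN computable_comp_tl]
      by (intro decidable_disj decidable_eq_0 decidable_less computable_mult computable_Suc
          computable_nth) simp_all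
    show "\<exists>q. G xs = 0 \<or> F xs < Suc q * G xs" for xs
      by (rule exI[of _ "F xs"]) (cases "G xs"; simp)
  qed
  moreover have "(LEAST q. b = 0 \<or> a < Suc q * b) = a div b" for a b :: nat
  proof (rule Least_equality)
    show "b = 0 \<or> a < Suc (a div b) * b"
      using dividend_less_div_times[of b a] by auto
    show "a div b \<le> q" if "b = 0 \<or> a < Suc q * b" for q
      using that less_mult_imp_div_less[of a "Suc q" b] by auto
  qed
  ultimately show ?thesis by simp
qed

lemma decidable_bit:
  assumes "computable_in g k F" "computable_in g k G"
  shows "decidable_in g k (\<lambda>xs. bit (F xs) (G xs))"
proof -
  define Q where "Q xs = F xs div 2 ^ G xs" for xs
  have odd_iff: "odd q \<longleftrightarrow> \<not> 2 * (q div 2) = q" for q :: nat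
    by presburger
  have "computable_in g k Q"
    unfolding Q_def using assms by (intro computable_div computable_power computable_const)
  then have "decidable_in g k (\<lambda>xs. odd (Q xs))"
    unfolding odd_iff
    by (intro decidable_not decidable_eq computable_mult computable_div computable_const)
  then show ?thesis by (simp add: bit_iff_odd Q_def)
qed

lemma computable_if_graph_enumerable:
  assumes R: "decidable_in g 3 (\<lambda>xs. R (xs ! 0) (xs ! 1) (xs ! 2))"
    and graph: "\<And>n m. h n = m \<longleftrightarrow> (\<exists>s. R s n m)"
  shows "computable_in g 1 (\<lambda>xs. h (xs ! 0))"
proof -
  have R_compose: "decidable_in g k (\<lambda>xs. R (S xs) (F xs) (G xs))"
    if "computable_in g k S" "computable_in g k F" "computable_in g k G" for k S F G
    using decidable_compose[OF R, of k "\<lambda>xs. [S xs, F xs, G xs]"] that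
    by (simp add: computable_tuple_Cons computable_tuple_Nil numeral_3_eq_3)
  define N where "N n = (LEAST N. \<exists>m<N. \<exists>s<N. R s n m)" for n
  have bound: "\<exists>N. \<exists>m<N. \<exists>s<N. R s n m" for n
  proof -
    obtain s where "R s n (h n)" using graph by blast
    then show ?thesis by (meson le_imp_less_Suc max.cobounded1 max.cobounded2)
  qed
  have "computable_in g 1 (\<lambda>xs. N (xs ! 0))"
    unfolding N_def
    by (intro computable_Least[OF _ bound] decidable_bex_less R_compose computable_nth
        computable_comp_tl) simp_all
  then have "computable_in g 1 (\<lambda>xs. LEAST m. \<exists>s<N (xs ! 0). R s (xs ! 0) m)"
    using LeastI_ex[OF bound, folded N_def]
    by (intro computable_Least decidable_bex_less R_compose computable_nth computable_comp_tl)
      (simp_all, blast)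
  moreover have "(LEAST m. \<exists>s<N n. R s n m) = h n" for n
  proof (rule Least_equality)
    obtain m s where "s < N n" "R s n m"
      using LeastI_ex[OF bound[of n], folded N_def] by blast
    then show "\<exists>s<N n. R s n (h n)" by (metis graph)
  qed (metis graph order_refl)
  ultimately show ?thesis by simp
qed

section \<open>Partial functions with decidable domain\<close>

definition computable_option_in ::
    "(nat \<Rightarrow> nat) \<Rightarrow> nat \<Rightarrow> (nat list \<Rightarrow> nat option) \<Rightarrow> bool" where
  "computable_option_in g k F \<longleftrightarrow> computable_in g k (\<lambda>xs. case_option 0 Suc (F xs))"

lemma computable_option_cong:
  "(\<And>xs. length xs = k \<Longrightarrow> F xs = G xs) \<Longrightarrow> computable_option_in g k F \<longleftrightarrow> computable_option_in g k G"
  unfolding computable_option_in_def by (intro computable_cong) simp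

lemma computable_option_None: "computable_option_in g k (\<lambda>xs. None)"
  by (simp add: computable_option_in_def computable_const)

lemma computable_option_Some:
  "computable_in g k F \<Longrightarrow> computable_option_in g k (\<lambda>xs. Some (F xs))"
  by (simp add: computable_option_in_def computable_Suc)

lemma computable_option_if:
  assumes "decidable_in g k P" "computable_option_in g k F" "computable_option_in g k G"
  shows "computable_option_in g k (\<lambda>xs. if P xs then F xs else G xs)"
  using computable_if[OF assms(1) assms(2,3)[unfolded computable_option_in_def]]
  by (simp add: computable_option_in_def if_distrib)

lemma computable_option_default:
  assumes "computable_option_in g k F"
  shows "computable_in g k (\<lambda>xs. case_option 0 id (F xs))"
proof -
  have "computable_in g k (\<lambda>xs. case_option 0 Suc (F xs) - 1)"
    using assms by (intro computable_pred) (simp add: computable_option_in_def)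
  moreover have "case_option 0 Suc r - 1 = case_option 0 id r" for r
    by (cases r) simp_all
  ultimately show ?thesis by simp
qed

lemma decidable_eq_option:
  assumes "computable_option_in g k F" "computable_option_in g k G"
  shows "decidable_in g k (\<lambda>xs. F xs = G xs)"
proof -
  have "decidable_in g k (\<lambda>xs. case_option 0 Suc (F xs) = case_option 0 Suc (G xs))"
    using assms by (intro decidable_eq) (simp_all add: computable_option_in_def)
  moreover have "case_option 0 Suc q = case_option 0 Suc r \<longleftrightarrow> q = r" for q r
    by (auto split: option.splits)
  ultimately show ?thesis by simp
qed

lemma computable_option_rec_nat:
  assumes F: "computable_option_in g k F"
    and G: "computable_option_in g (Suc (Suc k)) (\<lambda>ys. G (ys ! 0) (ys ! 1) (tl (tl ys)))"
    and N: "computable_in g k N"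
  shows "computable_option_in g k (\<lambda>xs. rec_nat (F xs) (\<lambda>n r. Option.bind r (\<lambda>y. G n y xs)) (N xs))"
proof -
  let ?G = "\<lambda>n r xs. if r = 0 then 0 else case_option 0 Suc (G n (r - 1) xs)"
  have "computable_in g (Suc (Suc k))
      (\<lambda>ys. case_option 0 Suc (G (ys ! 0) (ys ! 1 - 1) (tl (tl ys))))"
    using computable_compose[OF G[unfolded computable_option_in_def],
        of "Suc (Suc k)" "\<lambda>ys. ys ! 0 # (ys ! 1 - 1) # tl (tl ys)"]
    by (simp add: computable_tuple_Cons computable_tuple_comp_tl computable_tuple_tl_id
        computable_nth computable_pred[unfolded One_nat_def])
  then have "computable_in g k (\<lambda>xs. rec_nat (case_option 0 Suc (F xs)) (\<lambda>n r. ?G n r xs) (N xs))"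
    using F N
    by (intro computable_rec_nat computable_if decidable_eq_0 computable_const computable_nth)
      (simp_all add: computable_option_in_def)
  moreover have "rec_nat (case_option 0 Suc (F xs)) (\<lambda>n r. ?G n r xs) m =
      case_option 0 Suc (rec_nat (F xs) (\<lambda>n r. Option.bind r (\<lambda>y. G n y xs)) m)" for xs m
    by (induction m) (auto split: option.splits bind_splits)
  ultimately show ?thesis by (simp add: computable_option_in_def)
qed

lemma computable_option_if_length:
  assumes "computable_tuple_in g k j H" and "P j \<Longrightarrow> computable_option_in g k F"
  shows "computable_option_in g k (\<lambda>xs. if P (length (H xs)) then F xs else None)"
proof -
  have "computable_option_in g k (\<lambda>xs. if P j then F xs else None)"
    using assms(2) by (cases "P j") (simp_all add: computable_option_None)
  also have "?this \<longleftrightarrow> ?thesis"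
    using assms(1) by (intro computable_option_cong) (simp add: computable_tuple_in_def)
  finally show ?thesis .
qed

lemma computable_option_strict_args:
  assumes F: "\<And>q. q \<in> set qs \<Longrightarrow> computable_option_in g k (F q)"
    and G: "\<And>Y. computable_tuple_in g k (length qs) Y \<Longrightarrow>
      computable_option_in g k (\<lambda>xs. G xs (Y xs))"
  shows "computable_option_in g k (\<lambda>xs. if \<exists>q\<in>set qs. F q xs = None then None
    else G xs (map (\<lambda>q. the (F q xs)) qs))"
proof -
  have "computable_option_in g k (\<lambda>xs. if \<exists>q\<in>set qs. F q xs = None then None
      else G xs (map (\<lambda>q. case_option 0 id (F q xs)) qs))"
    by (intro computable_option_if decidable_bex_finite decidable_eq_option computable_option_None
        G computable_tuple_map computable_option_default F finite_set)
  also have "(\<lambda>xs. if \<exists>q\<in>set qs. F q xs = None then None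
      else G xs (map (\<lambda>q. case_option 0 id (F q xs)) qs)) =
      (\<lambda>xs. if \<exists>q\<in>set qs. F q xs = None then None else G xs (map (\<lambda>q. the (F q xs)) qs))"
    by (rule ext) (simp add: option.case_eq_if del: not_None_eq cong: map_cong if_cong)
  finally show ?thesis .
qed

lemma computable_option_rec_nat_args:
  assumes H: "computable_tuple_in g k j H"
    and F: "\<And>Y. computable_tuple_in g k (j - 1) Y \<Longrightarrow> computable_option_in g k (\<lambda>xs. F xs (Y xs))"
    and G: "\<And>Y. computable_tuple_in g (Suc (Suc k)) (Suc (Suc (j - 1))) Y \<Longrightarrow>
      computable_option_in g (Suc (Suc k)) (\<lambda>ys. G (tl (tl ys)) (Y ys))"
  shows "computable_option_in g k (\<lambda>xs. if 0 < length (H xs)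
    then rec_nat (F xs (tl (H xs))) (\<lambda>n r. Option.bind r (\<lambda>y. G xs (n # y # tl (H xs)))) (H xs ! 0)
    else None)"
proof -
  have "computable_tuple_in g (Suc (Suc k)) (Suc (Suc (j - 1)))
      (\<lambda>ys. ys ! 0 # ys ! 1 # tl (H (tl (tl ys))))"
    by (intro computable_tuple_Cons computable_nth computable_tuple_comp_tl computable_tuple_tl H)
      simp_all
  then have "computable_option_in g (Suc (Suc k))
      (\<lambda>ys. G (tl (tl ys)) (ys ! 0 # ys ! 1 # tl (H (tl (tl ys)))))"
    by (rule G)
  then show ?thesis
    by (intro computable_option_if_length[OF H] computable_option_rec_nat F computable_tuple_tl
        computable_tuple_nth[OF H] H)
qed

section \<open>Bounded evaluation of programs\<close>

definition bounded_search :: "nat \<Rightarrow> (nat \<Rightarrow> nat option) \<Rightarrow> nat option" where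
  "bounded_search s \<phi> =
    (let y = LEAST y. y = s \<or> \<phi> y = None \<or> \<phi> y = Some 0 in if \<phi> y = Some 0 then Some y else None)"

lemma bounded_search_SomeD:
  assumes "bounded_search s \<phi> = Some y"
  shows "\<phi> y = Some 0" and "z < y \<Longrightarrow> \<exists>w. \<phi> z = Some (Suc w)"
proof -
  from assms have y: "y = (LEAST y. y = s \<or> \<phi> y = None \<or> \<phi> y = Some 0)" "\<phi> y = Some 0"
    by (auto simp: bounded_search_def Let_def split: if_splits)
  show "\<phi> y = Some 0" by (rule y(2))
  assume "z < y"
  then have "\<not> (z = s \<or> \<phi> z = None \<or> \<phi> z = Some 0)"
    unfolding y(1) by (rule not_less_Least)
  then show "\<exists>w. \<phi> z = Some (Suc w)"
    by (metis not0_implies_Suc option.exhaust)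
qed

lemma bounded_search_eqI:
  assumes "y \<le> s" "\<phi> y = Some 0" "\<And>z. z < y \<Longrightarrow> \<phi> z \<notin> {None, Some 0}"
  shows "bounded_search s \<phi> = Some y"
proof -
  have "(LEAST y. y = s \<or> \<phi> y = None \<or> \<phi> y = Some 0) = y"
  proof (rule Least_equality)
    show "y = s \<or> \<phi> y = None \<or> \<phi> y = Some 0"
      using assms(2) by simp
    show "y \<le> z" if "z = s \<or> \<phi> z = None \<or> \<phi> z = Some 0" for z
      using that assms(1) assms(3)[of z] by (cases "z < y") auto
  qed
  with assms(2) show ?thesis by (simp add: bounded_search_def)
qed

lemma computable_bounded_search:
  assumes S: "computable_in g k S"
    and \<phi>: "computable_option_in g (Suc k) (\<lambda>ys. \<phi> (ys ! 0) (tl ys))"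
  shows "computable_option_in g k (\<lambda>xs. bounded_search (S xs) (\<lambda>y. \<phi> y xs))"
proof -
  define Y where "Y xs = (LEAST y. y = S xs \<or> \<phi> y xs = None \<or> \<phi> y xs = Some 0)" for xs
  have Y: "computable_in g k Y"
    unfolding Y_def using S \<phi>
    by (intro computable_Least decidable_disj decidable_eq decidable_eq_option
        computable_option_None computable_option_Some computable_const computable_nth
        computable_comp_tl) auto
  have "computable_option_in g k (\<lambda>xs. \<phi> (Y xs) xs)"
    using computable_compose[OF \<phi>[unfolded computable_option_in_def]
        computable_tuple_Cons[OF Y computable_tuple_id]]
    by (simp add: computable_option_in_def)
  then have "computable_option_in g k (\<lambda>xs. if \<phi> (Y xs) xs = Some 0 then Some (Y xs) else None)"
    using Y by (intro computable_option_if decidable_eq_option computable_option_None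
        computable_option_Some computable_const)
  then show ?thesis
    unfolding bounded_search_def Let_def Y_def .
qed

text \<open>Only the unbounded searches are cut off, at \<open>s\<close>.\<close>

fun bounded_eval :: "recf \<Rightarrow> nat \<Rightarrow> (nat \<Rightarrow> nat) \<Rightarrow> nat list \<Rightarrow> nat option" where
  "bounded_eval Zero s g xs = Some 0"
| "bounded_eval Succ s g xs = (if length xs = 1 then Some (Suc (xs ! 0)) else None)"
| "bounded_eval (Proj i) s g xs = (if i < length xs then Some (xs ! i) else None)"
| "bounded_eval Oracle s g xs = (if length xs = 1 then Some (g (xs ! 0)) else None)"
| "bounded_eval (Comp p qs) s g xs =
    (if \<exists>q\<in>set qs. bounded_eval q s g xs = None then None
     else bounded_eval p s g (map (\<lambda>q. the (bounded_eval q s g xs)) qs))"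
| "bounded_eval (PrimRec p q) s g xs =
    (if 0 < length xs
     then rec_nat (bounded_eval p s g (tl xs))
       (\<lambda>n r. Option.bind r (\<lambda>y. bounded_eval q s g (n # y # tl xs))) (xs ! 0)
     else None)"
| "bounded_eval (Mu p) s g xs = bounded_search s (\<lambda>y. bounded_eval p s g (y # xs))"

lemma bounded_eval_CompI:
  assumes "list_all2 (\<lambda>q y. bounded_eval q s g xs = Some y) qs ys" "bounded_eval p s g ys = Some z"
  shows "bounded_eval (Comp p qs) s g xs = Some z"
proof -
  have "\<forall>q\<in>set qs. bounded_eval q s g xs \<noteq> None"
    using assms(1) by (auto simp: list_all2_conv_all_nth in_set_conv_nth)
  moreover have "map (\<lambda>q. the (bounded_eval q s g xs)) qs = ys"
    using assms(1) by (intro nth_equalityI) (auto simp: list_all2_conv_all_nth)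
  ultimately show ?thesis using assms(2) by simp
qed

lemma bounded_eval_PrimRec_sound:
  assumes p: "\<And>xs y. bounded_eval p s g xs = Some y \<Longrightarrow> rec_eval g p xs y"
    and q: "\<And>xs y. bounded_eval q s g xs = Some y \<Longrightarrow> rec_eval g q xs y"
    and "bounded_eval (PrimRec p q) s g (n # zs) = Some y"
  shows "rec_eval g (PrimRec p q) (n # zs) y"
  using assms(3)
proof (induction n arbitrary: y)
  case 0
  then show ?case by (simp add: rec_eval_PrimRec_0 p)
next
  case (Suc n)
  then obtain r where "bounded_eval (PrimRec p q) s g (n # zs) = Some r"
    "bounded_eval q s g (n # r # zs) = Some y"
    by (auto simp: bind_eq_Some_conv)
  then show ?case by (blast intro: rec_eval_PrimRec_Suc Suc.IH q)
qed

lemma bounded_eval_sound: "bounded_eval p s g xs = Some y \<Longrightarrow> rec_eval g p xs y"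
proof (induction p arbitrary: xs y)
  case (Comp p qs)
  let ?ys = "map (\<lambda>q. the (bounded_eval q s g xs)) qs"
  from Comp.prems have args: "\<forall>q\<in>set qs. bounded_eval q s g xs \<noteq> None"
    and result: "bounded_eval p s g ?ys = Some y"
    by (auto split: if_splits)
  show ?case
  proof (rule rec_eval_Comp)
    show "rec_eval g p ?ys y" using result by (rule Comp.IH)
    show "list_all2 (\<lambda>q y. rec_eval g q xs y) qs ?ys"
      using args Comp.IH(2) by (auto simp: list_all2_conv_all_nth)
  qed
next
  case (PrimRec p q)
  then obtain n zs where "xs = n # zs" by (cases xs) auto
  with PrimRec show ?case using bounded_eval_PrimRec_sound by blast
next
  case (Mu p)
  then have "bounded_search s (\<lambda>y. bounded_eval p s g (y # xs)) = Some y" by simp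
  note search = bounded_search_SomeD[OF this]
  show ?case
  proof (rule rec_eval_Mu)
    show "rec_eval g p (y # xs) 0"
      using search(1) by (rule Mu.IH)
    show "\<exists>w. rec_eval g p (z # xs) (Suc w)" if "z < y" for z
      using search(2)[OF that] Mu.IH by blast
  qed
qed (auto split: if_splits simp: length_Suc_conv intro: rec_eval.intros)

definition cylinder :: "(nat \<Rightarrow> 'a) \<Rightarrow> nat \<Rightarrow> (nat \<Rightarrow> 'a) set" where
  "cylinder A l = {X. \<forall>i<l. X i = A i}"

definition settled :: "nat \<Rightarrow> recf \<Rightarrow> (nat \<Rightarrow> nat) \<Rightarrow> nat list \<Rightarrow> nat \<Rightarrow> bool" where
  "settled u p g xs y \<longleftrightarrow> (\<forall>s\<ge>u. \<forall>g'\<in>cylinder g u. bounded_eval p s g' xs = Some y)"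

lemma settled_CompI:
  assumes "list_all2 (\<lambda>q y. settled u q g xs y) qs ys" "settled u p g ys z"
  shows "settled u (Comp p qs) g xs z"
  using assms unfolding settled_def
  by (intro allI impI ballI bounded_eval_CompI[where ys = ys]) (auto elim: list_all2_mono)

lemma settled_MuI:
  assumes "y \<le> u" "settled u p g (y # xs) 0"
    and below: "\<And>z. z < y \<Longrightarrow> \<exists>w. settled u p g (z # xs) (Suc w)"
  shows "settled u (Mu p) g xs y"
  unfolding settled_def bounded_eval.simps
proof (intro allI impI ballI bounded_search_eqI)
  fix s g' assume s: "u \<le> s" and g': "g' \<in> cylinder g u"
  show "y \<le> s" using \<open>y \<le> u\<close> s by (rule order_trans)
  show "bounded_eval p s g' (y # xs) = Some 0"
    using assms(2) s g' by (simp add: settled_def)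
  fix z assume "z < y"
  with below obtain w where "settled u p g (z # xs) (Suc w)" by blast
  with s g' show "bounded_eval p s g' (z # xs) \<notin> {None, Some 0}"
    by (simp add: settled_def)
qed

lemma use_principle:
  assumes "rec_eval g p xs y"
  shows "\<forall>\<^sub>F u in sequentially. settled u p g xs y"
  using assms
proof (induction rule: rec_eval.induct)
  case (rec_eval_Oracle x)
  show ?case
    using eventually_gt_at_top[of x] by eventually_elim (simp add: settled_def cylinder_def)
next
  case (rec_eval_Comp xs qs ys p z)
  have "\<forall>\<^sub>F u in sequentially. \<forall>i\<in>{..<length qs}. settled u (qs ! i) g xs (ys ! i)"
    using rec_eval_Comp.IH(1) by (intro eventually_ball_finite) (auto simp: list_all2_conv_all_nth)
  then have "\<forall>\<^sub>F u in sequentially. list_all2 (\<lambda>q y. settled u q g xs y) qs ys"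
    using list_all2_lengthD[OF rec_eval_Comp.IH(1)] by (simp add: list_all2_conv_all_nth Ball_def)
  with rec_eval_Comp.IH(2) show ?case
    by eventually_elim (rule settled_CompI)
next
  case (rec_eval_PrimRec_Suc p q n xs r y)
  from rec_eval_PrimRec_Suc.IH show ?case
    by eventually_elim (simp add: settled_def)
next
  case (rec_eval_Mu p y xs)
  have "\<forall>\<^sub>F u in sequentially. \<forall>z\<in>{..<y}. \<exists>w. settled u p g (z # xs) (Suc w)"
  proof (intro eventually_ball_finite ballI finite_lessThan)
    fix z assume "z \<in> {..<y}"
    then obtain w where "\<forall>\<^sub>F u in sequentially. settled u p g (z # xs) (Suc w)"
      using rec_eval_Mu.IH(2) by blast
    then show "\<forall>\<^sub>F u in sequentially. \<exists>w. settled u p g (z # xs) (Suc w)"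
      by eventually_elim blast
  qed
  with rec_eval_Mu.IH(1) eventually_ge_at_top[of y] show ?case
    by eventually_elim (auto intro: settled_MuI)
qed (simp_all add: settled_def)

lemma computable_bounded_eval:
  assumes L: "computable_in g (Suc m) (\<lambda>ys. L (tl ys) (ys ! 0))"
    and "computable_in g k S" "computable_tuple_in g k m E" "computable_tuple_in g k j H"
  shows "computable_option_in g k (\<lambda>xs. bounded_eval p (S xs) (L (E xs)) (H xs))"
  using assms(2-4)
proof (induction p arbitrary: k j S E H)
  case Zero
  show ?case by (simp add: computable_option_Some computable_const)
next
  case Succ
  show ?case unfolding bounded_eval.simps
    by (rule computable_option_if_length[OF Succ(3)])
      (intro computable_option_Some computable_Suc computable_tuple_nth[OF Succ(3)], simp)
next
  case (Proj i)
  show ?case unfolding bounded_eval.simps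
    by (rule computable_option_if_length[OF Proj(3)])
      (intro computable_option_Some computable_tuple_nth[OF Proj(3)])
next
  case Oracle
  have "computable_in g k (\<lambda>xs. L (E xs) (H xs ! 0))" if "j = 1"
    using computable_compose[OF L computable_tuple_Cons[OF computable_tuple_nth[OF Oracle(3), of 0]
          Oracle(2)]] that
    by simp
  then show ?case unfolding bounded_eval.simps
    by (rule computable_option_if_length[OF Oracle(3) computable_option_Some])
next
  case (Comp p qs)
  show ?case
    unfolding bounded_eval.simps
    by (intro computable_option_strict_args Comp.IH(1)[OF Comp.prems(1,2)]
        Comp.IH(2)[OF _ Comp.prems])
next
  case (PrimRec p q)
  show ?case
    unfolding bounded_eval.simps using PrimRec.prems
    by (intro computable_option_rec_nat_args PrimRec.IH computable_comp_tl computable_tuple_comp_tl)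
next
  case (Mu p)
  show ?case
    unfolding bounded_eval.simps using Mu.prems
    by (intro computable_bounded_search Mu.IH[where j = "Suc j"] computable_tuple_Cons
        computable_nth computable_comp_tl computable_tuple_comp_tl) simp_all
qed

section \<open>Baire category\<close>

abbreviation baire_topology :: "(nat \<Rightarrow> 'a) topology" where
  "baire_topology \<equiv> product_topology (\<lambda>_. discrete_topology UNIV) UNIV"

lemma openin_cylinder: "openin baire_topology (cylinder A l)"
proof -
  have "cylinder A l = (\<Pi>\<^sub>E i\<in>UNIV. if i < l then {A i} else UNIV)"
    by (auto simp: cylinder_def PiE_iff if_split_mem2)
  moreover have "finite {i :: nat. (if i < l then {A i} else UNIV) \<noteq> UNIV}"
    by (rule finite_subset[of _ "{..<l}"]) auto
  ultimately show ?thesis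
    by (simp add: openin_PiE_gen)
qed

lemma cylinder_neighbourhood:
  assumes "openin baire_topology U" "S \<in> U"
  obtains l where "cylinder S l \<subseteq> U"
proof -
  obtain V where V: "finite {i. V i \<noteq> UNIV}" "S \<in> Pi\<^sub>E UNIV V" "Pi\<^sub>E UNIV V \<subseteq> U"
    using bspec[OF assms(1)[unfolded openin_product_topology_alt] assms(2)] by auto
  from V(1) obtain l where l: "{i. V i \<noteq> UNIV} \<subseteq> {..<l}"
    unfolding finite_nat_iff_bounded by blast
  have "X i \<in> V i" if X: "X \<in> cylinder S l" for X i
  proof (cases "V i = UNIV")
    case False
    then have "X i = S i" using l X by (auto simp: cylinder_def)
    then show ?thesis using V(2) by (simp add: PiE_iff)
  qed simp
  then have "cylinder S l \<subseteq> Pi\<^sub>E UNIV V"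
    by (simp add: subset_iff PiE_iff)
  with V(3) have "cylinder S l \<subseteq> U" by (rule subset_trans[rotated])
  then show ?thesis by (rule that)
qed

lemma countable_cover_dense_in_cylinder:
  fixes C :: "'b::countable \<Rightarrow> (nat \<Rightarrow> 'a) set"
  assumes cover: "\<And>X. \<exists>p. X \<in> C p"
  obtains p S l where "\<And>A m. A \<in> cylinder S l \<Longrightarrow> \<exists>X\<in>cylinder A m. X \<in> C p"
proof -
  have "\<exists>p. baire_topology interior_of (baire_topology closure_of C p) \<noteq> {}"
  proof (rule ccontr)
    assume "\<not> ?thesis"
    then have "baire_topology interior_of \<Union>(range (\<lambda>p. baire_topology closure_of C p)) = {}"
      by (intro Baire_category_alt disjI1)
        (auto simp: completely_metrizable_space_product_topology
          completely_metrizable_space_discrete_topology)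
    moreover have "C p \<subseteq> baire_topology closure_of C p" for p
      by (simp add: closure_of_subset)
    with cover have "\<Union>(range (\<lambda>p. baire_topology closure_of C p)) = UNIV"
      by blast
    moreover have "baire_topology interior_of UNIV = UNIV"
      using interior_of_topspace[of baire_topology] by simp
    ultimately show False by (metis UNIV_not_empty)
  qed
  then obtain p S where "S \<in> baire_topology interior_of (baire_topology closure_of C p)"
    by blast
  with openin_interior_of obtain l where
    "cylinder S l \<subseteq> baire_topology interior_of (baire_topology closure_of C p)"
    by (rule cylinder_neighbourhood)
  then have l: "cylinder S l \<subseteq> baire_topology closure_of C p"
    using interior_of_subset by (rule subset_trans)
  have "\<exists>X\<in>cylinder A m. X \<in> C p" if "A \<in> cylinder S l" for A m
  proof -
    have "A \<in> baire_topology closure_of C p" "A \<in> cylinder A m"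
      using l that by (auto simp: cylinder_def)
    then show ?thesis
      using openin_cylinder[of A m] by (auto simp: in_closure_of)
  qed
  with that show ?thesis .
qed

lemma frequently_bit_in_cylinder: "\<exists>\<^sub>F s in sequentially. bit (s :: nat) \<in> cylinder A N"
  unfolding frequently_sequentially
proof
  fix M
  show "\<exists>s\<ge>M. bit (s :: nat) \<in> cylinder A N"
  proof (induction N arbitrary: A)
    case (Suc N)
    from Suc[of "\<lambda>i. A (Suc i)"] obtain s :: nat where s: "M \<le> s" "\<forall>i<N. bit s i = A (Suc i)"
      by (auto simp: cylinder_def)
    have "bit (of_bool (A 0) + 2 * s) i = A i" if "i < Suc N" for i
      using that s(2) by (cases i) (auto simp: bit_0 bit_Suc)
    with s(1) show ?case
      by (intro exI[of _ "of_bool (A 0) + 2 * s"]) (auto simp: cylinder_def)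
  qed (auto simp: cylinder_def)
qed

section \<open>Reductions of pullbacks\<close>

definition reduces :: "recf \<Rightarrow> cantor \<Rightarrow> cantor \<Rightarrow> bool" where
  "reduces p A B \<longleftrightarrow> (\<forall>n. rec_eval (characteristic B) p [n] (of_bool (A n)))"

lemma turing_le_iff_reduces: "A \<le>\<^sub>T B \<longleftrightarrow> (\<exists>p. reduces p A B)"
  unfolding turing_le_def recursive_in_def reduces_def ..

lemma characteristic_in_cylinder:
  "X \<in> cylinder A l \<Longrightarrow> characteristic X \<in> cylinder (characteristic A) l"
  by (simp add: cylinder_def)

instance recf :: countable
  by countable_datatype

locale dense_reduction =
  fixes p :: recf and h :: "nat \<Rightarrow> nat" and S :: cantor and l :: nat
  assumes dense: "A \<in> cylinder S l \<Longrightarrow> \<exists>X\<in>cylinder A m. reduces p (pullback h X) X"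
begin

lemma halting_computation_correct:
  assumes A: "A \<in> cylinder S l" and halt: "rec_eval (characteristic A) p [n] y"
  shows "y = of_bool (A (h n))"
proof -
  obtain u where u: "settled u p (characteristic A) [n] y"
    using use_principle[OF halt] by (auto simp: eventually_sequentially)
  obtain X where X: "X \<in> cylinder A (max u (Suc (h n)))" and red: "reduces p (pullback h X) X"
    using dense[OF A] by blast
  have "X \<in> cylinder A u" using X by (simp add: cylinder_def)
  then have "rec_eval (characteristic X) p [n] y"
    using u by (intro bounded_eval_sound[of p u]) (simp add: settled_def characteristic_in_cylinder)
  moreover have "rec_eval (characteristic X) p [n] (of_bool (X (h n)))"
    using red by (simp add: reduces_def pullback_def)
  ultimately have "y = of_bool (X (h n))" by (rule rec_eval_det)
  also have "X (h n) = A (h n)" using X by (simp add: cylinder_def)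
  finally show ?thesis .
qed

lemma use_principle_reduces:
  assumes "reduces p (pullback h X) X"
  shows "\<exists>u. \<forall>s\<ge>u. \<forall>Z\<in>cylinder X u.
    bounded_eval p s (characteristic Z) [n] = Some (of_bool (X (h n)))"
proof -
  have "rec_eval (characteristic X) p [n] (of_bool (X (h n)))"
    using assms by (simp add: reduces_def pullback_def)
  then obtain u where "settled u p (characteristic X) [n] (of_bool (X (h n)))"
    using use_principle eventually_happens trivial_limit_sequentially by metis
  then show ?thesis
    unfolding settled_def using characteristic_in_cylinder by blast
qed

lemma ex_oracle_deciding_both_ways:
  assumes "l \<le> h n"
  obtains Y u where "Y \<in> cylinder S l"
    "\<And>b s Z. u \<le> s \<Longrightarrow> Z \<in> cylinder (Y(h n := b)) u \<Longrightarrow>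
      bounded_eval p s (characteristic Z) [n] = Some (of_bool b)"
proof -
  have "S(h n := False) \<in> cylinder S l" using assms by (simp add: cylinder_def)
  from dense[OF this, of "Suc (h n)"] obtain X where
    X: "X \<in> cylinder (S(h n := False)) (Suc (h n))" and red_X: "reduces p (pullback h X) X"
    by blast
  have "\<not> X (h n)" using X by (simp add: cylinder_def)
  with use_principle_reduces[OF red_X, of n] obtain v where
    v: "\<And>s Z. v \<le> s \<Longrightarrow> Z \<in> cylinder X v \<Longrightarrow> bounded_eval p s (characteristic Z) [n] = Some 0"
    by auto
  have "X(h n := True) \<in> cylinder S l" using X assms by (auto simp: cylinder_def)
  from dense[OF this, of "max v (Suc (h n))"] obtain Y where
    Y: "Y \<in> cylinder (X(h n := True)) (max v (Suc (h n)))" and red_Y: "reduces p (pullback h Y) Y"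
    by blast
  have "Y (h n)" using Y by (simp add: cylinder_def)
  with use_principle_reduces[OF red_Y, of n] obtain w where
    w: "\<And>s Z. w \<le> s \<Longrightarrow> Z \<in> cylinder Y w \<Longrightarrow> bounded_eval p s (characteristic Z) [n] = Some 1"
    by auto
  show ?thesis
  proof (rule that)
    show "Y \<in> cylinder S l" using X Y assms by (auto simp: cylinder_def)
    fix b s Z assume s: "max v w \<le> s" and Z: "Z \<in> cylinder (Y(h n := b)) (max v w)"
    show "bounded_eval p s (characteristic Z) [n] = Some (of_bool b)"
    proof (cases b)
      case True
      with Z \<open>Y (h n)\<close> have "Z \<in> cylinder Y w" by (auto simp: cylinder_def)
      with w s True show ?thesis by simp
    next
      case False
      with Z Y \<open>\<not> X (h n)\<close> have "Z \<in> cylinder X v" by (auto simp: cylinder_def)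
      with v s False show ?thesis by simp
    qed
  qed
qed

definition approx :: "nat \<Rightarrow> cantor" where
  "approx s i = (if i < l then S i else bit s i)"

text \<open>
  The number \<open>s\<close> is both the bound of the evaluation and, through its bits, the finite oracle; this
  saves coding pairs.
\<close>

definition splits :: "nat \<Rightarrow> nat \<Rightarrow> nat \<Rightarrow> bool" where
  "splits s n m \<longleftrightarrow> l \<le> m \<and>
    (\<forall>b. bounded_eval p s (characteristic ((approx s)(m := b))) [n] = Some (of_bool b))"

lemma splits_imp_eq:
  assumes "splits s n m"
  shows "h n = m"
proof (rule ccontr)
  assume "h n \<noteq> m"
  have "approx s (h n) = b" for b
  proof -
    have "(approx s)(m := b) \<in> cylinder S l"
      using assms by (auto simp: splits_def approx_def cylinder_def)
    moreover have "rec_eval (characteristic ((approx s)(m := b))) p [n] (of_bool b)"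
      using assms unfolding splits_def by (blast intro: bounded_eval_sound)
    ultimately have "of_bool b = (of_bool (((approx s)(m := b)) (h n)) :: nat)"
      by (rule halting_computation_correct)
    with \<open>h n \<noteq> m\<close> show ?thesis by (simp add: of_bool_eq_iff)
  qed
  from this[of True] this[of False] show False by simp
qed

lemma ex_splits:
  assumes "l \<le> h n"
  shows "\<exists>s. splits s n (h n)"
proof -
  obtain Y u where Y: "Y \<in> cylinder S l" and
    u: "\<And>b s Z. u \<le> s \<Longrightarrow> Z \<in> cylinder (Y(h n := b)) u \<Longrightarrow>
      bounded_eval p s (characteristic Z) [n] = Some (of_bool b)"
    using ex_oracle_deciding_both_ways[OF assms] by blast
  obtain s where s: "u \<le> s" "bit s \<in> cylinder Y u"
    using frequently_bit_in_cylinder[of Y u] by (auto simp: frequently_sequentially)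
  with Y have "(approx s)(h n := b) \<in> cylinder (Y(h n := b)) u" for b
    by (auto simp: approx_def cylinder_def)
  with u s(1) assms have "splits s n (h n)"
    by (simp only: splits_def) blast
  then show ?thesis ..
qed

lemma decidable_approx:
  assumes "computable_in g k F" "computable_in g k G"
  shows "decidable_in g k (\<lambda>xs. approx (F xs) (G xs))"
proof -
  have "decidable_in g k (\<lambda>xs. (\<exists>a\<in>{a. a < l \<and> S a}. G xs = a) \<or> \<not> G xs < l \<and> bit (F xs) (G xs))"
    using assms by (intro decidable_disj decidable_bex_finite decidable_conj decidable_not
        decidable_eq decidable_less decidable_bit computable_const) auto
  also have "(\<lambda>xs. (\<exists>a\<in>{a. a < l \<and> S a}. G xs = a) \<or> \<not> G xs < l \<and> bit (F xs) (G xs)) =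
      (\<lambda>xs. approx (F xs) (G xs))"
    by (auto simp: approx_def)
  finally show ?thesis .
qed

lemma decidable_splits: "decidable_in g 3 (\<lambda>xs. splits (xs ! 0) (xs ! 1) (xs ! 2))"
proof -
  define L where "L b xs = characteristic ((approx (xs ! 0))(xs ! 2 := b))" for b xs
  have "decidable_in g (Suc 3)
      (\<lambda>ys. if ys ! 0 = tl ys ! 2 then b else approx (tl ys ! 0) (ys ! 0))" for b
    by (intro decidable_if decidable_const decidable_eq decidable_approx computable_nth
        computable_comp_tl) simp_all
  then have L: "computable_in g (Suc 3) (\<lambda>ys. L b (tl ys) (ys ! 0))" for b
    by (simp add: L_def decidable_in_def)
  have "computable_option_in g 3 (\<lambda>xs. bounded_eval p (xs ! 0) (L b xs) [xs ! 1])" for b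
    by (intro computable_bounded_eval[OF L, where E = "\<lambda>xs. xs" and j = "Suc 0"]
        computable_tuple_id computable_tuple_Cons computable_tuple_Nil computable_nth) simp_all
  then have "decidable_in g 3 (\<lambda>xs. \<not> xs ! 2 < l \<and>
      \<not> (\<exists>b\<in>UNIV. \<not> bounded_eval p (xs ! 0) (L b xs) [xs ! 1] = Some (of_bool b)))"
    by (intro decidable_conj decidable_not decidable_bex_finite decidable_less decidable_eq_option
        computable_option_Some computable_const computable_nth) simp_all
  then show ?thesis
    by (simp only: splits_def L_def not_less bex_UNIV not_ex not_not)
qed

end

lemma decidable_fiber_if_pullback_le:
  assumes "pullback h (\<lambda>m. m = i) \<le>\<^sub>T (\<lambda>m. m = i)"
  shows "decidable_in (\<lambda>_. 0) 1 (\<lambda>xs. h (xs ! 0) = i)"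
proof -
  have "(\<lambda>m. m = i) \<le>\<^sub>T (\<lambda>_. False)"
    unfolding turing_le_iff_decidable_in
    by (intro decidable_eq computable_nth computable_const) simp
  with assms have "pullback h (\<lambda>m. m = i) \<le>\<^sub>T (\<lambda>_. False)"
    by (rule turing_le_trans)
  then show ?thesis
    by (simp add: turing_le_iff_decidable_in pullback_def)
qed

lemma dense_reduction_if_pullback_le:
  assumes "\<And>A. pullback h A \<le>\<^sub>T A"
  obtains p S l where "dense_reduction p h S l"
proof -
  have "\<exists>p. X \<in> {X. reduces p (pullback h X) X}" for X
    using assms turing_le_iff_reduces by simp
  then obtain p S l where
    "\<And>A m. A \<in> cylinder S l \<Longrightarrow> \<exists>X\<in>cylinder A m. X \<in> {X. reduces p (pullback h X) X}"
    by (rule countable_cover_dense_in_cylinder) blast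
  then have "dense_reduction p h S l"
    by unfold_locales simp
  then show ?thesis by (rule that)
qed

theorem recursive_if_pullback_le:
  assumes le: "\<And>A. pullback h A \<le>\<^sub>T A"
  shows "recursive h"
proof -
  obtain p S l where "dense_reduction p h S l"
    using dense_reduction_if_pullback_le[OF le] .
  then interpret dense_reduction p h S l .
  define R where "R s n m \<longleftrightarrow> (\<exists>i\<in>{..<l}. h n = i \<and> m = i) \<or> splits s n m" for s n m
  have "decidable_in (\<lambda>_. 0) 3 (\<lambda>xs. R (xs ! 0) (xs ! 1) (xs ! 2))"
    unfolding R_def
    by (intro decidable_disj decidable_bex_finite decidable_conj decidable_eq decidable_splits
        decidable_compose1[OF decidable_fiber_if_pullback_le[OF le]] computable_nth
        computable_const) simp_all
  moreover have "h n = m \<longleftrightarrow> (\<exists>s. R s n m)" for n m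
  proof
    assume m: "h n = m"
    then show "\<exists>s. R s n m"
      by (cases "m < l") (use ex_splits[of n] in \<open>auto simp: R_def not_less\<close>)
  qed (auto simp: R_def dest: splits_imp_eq)
  ultimately show ?thesis
    unfolding recursive_iff_computable_in by (rule computable_if_graph_enumerable)
qed

lemma pullback_le_if_recursive:
  assumes "recursive h"
  shows "pullback h A \<le>\<^sub>T A"
proof -
  have "computable_in (characteristic A) 1 (\<lambda>xs. h (xs ! 0))"
    using assms unfolding recursive_iff_computable_in by (rule computable_in_if_computable_in_zero)
  from computable_oracle[OF this] show ?thesis
    by (simp add: turing_le_iff_decidable_in decidable_in_def pullback_def)
qed

lemma pullback_conjugate_le:
  assumes "bij f" and \<pi>: "\<And>A. \<pi> (deg A) = deg (pullback f A)" "degree_automorphism \<pi>"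
    and "recursive h"
  shows "pullback (inv f \<circ> h \<circ> f) A \<le>\<^sub>T A"
proof -
  define B where "B = pullback (inv f) A"
  have "deg (pullback h B) \<le> deg B"
    using pullback_le_if_recursive[OF \<open>recursive h\<close>] by (simp add: less_eq_turing_degree.abs_eq)
  then have "deg (pullback f (pullback h B)) \<le> deg (pullback f B)"
    using \<pi> unfolding degree_automorphism_def by metis
  moreover have "pullback f B = A"
    using \<open>bij f\<close> by (simp add: B_def pullback_def bij_is_inj)
  moreover have "pullback f (pullback h B) = pullback (inv f \<circ> h \<circ> f) A"
    by (simp add: B_def pullback_def)
  ultimately show ?thesis
    by (simp add: less_eq_turing_degree.abs_eq)
qed

lemma recursive_Suc: "recursive Suc"
  unfolding recursive_iff_computable_in by (intro computable_Suc computable_nth) simp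

lemma recursive_funpow:
  assumes "recursive h"
  shows "recursive (\<lambda>n. (h ^^ n) a)"
proof -
  have "computable_in (\<lambda>_. 0) 1 (\<lambda>xs. rec_nat a (\<lambda>_ r. h r) (xs ! 0))"
    by (intro computable_rec_nat computable_compose1[OF assms[unfolded recursive_iff_computable_in]]
        computable_const computable_nth) simp_all
  moreover have "rec_nat a (\<lambda>_ r. h r) n = (h ^^ n) a" for n
    by (induction n) simp_all
  ultimately show ?thesis
    by (simp add: recursive_iff_computable_in)
qed

lemma recursive_inv:
  assumes "bij h" "recursive h"
  shows "recursive (inv h)"
proof -
  have "\<exists>m. h m = n" for n
    using \<open>bij h\<close> by (metis bij_pointE)
  then have "computable_in (\<lambda>_. 0) 1 (\<lambda>xs. LEAST m. h m = xs ! 0)"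
    by (intro computable_Least decidable_eq computable_nth computable_comp_tl
        computable_compose1[OF assms(2)[unfolded recursive_iff_computable_in]]) simp_all
  moreover have "(LEAST m. h m = n) = inv h n" for n
    using \<open>bij h\<close> by (intro Least_equality) (auto simp: bij_is_surj surj_f_inv_f bij_is_inj)
  ultimately show ?thesis
    by (simp add: recursive_iff_computable_in)
qed

lemma funpow_conjugate_Suc:
  assumes "bij f"
  shows "((inv f \<circ> Suc \<circ> f) ^^ n) (inv f 0) = inv f n"
  using assms by (induction n) (simp_all add: bij_is_surj surj_f_inv_f)

theorem theorem6p2:
  fixes f :: "nat \<Rightarrow> nat" and \<pi> :: "turing_degree \<Rightarrow> turing_degree"
  assumes "bij f"
    and "\<And>A. \<pi> (deg A) = deg (pullback f A)"
    and "degree_automorphism \<pi>"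
  shows "recursive f"
proof -
  have "pullback (inv f \<circ> Suc \<circ> f) A \<le>\<^sub>T A" for A
    using assms recursive_Suc by (rule pullback_conjugate_le)
  then have "recursive (inv f \<circ> Suc \<circ> f)"
    by (rule recursive_if_pullback_le)
  then have "recursive (\<lambda>n. ((inv f \<circ> Suc \<circ> f) ^^ n) (inv f 0))"
    by (rule recursive_funpow)
  then have "recursive (inv f)"
    using \<open>bij f\<close> by (simp add: funpow_conjugate_Suc)
  then have "recursive (inv (inv f))"
    using \<open>bij f\<close> by (rule recursive_inv[rotated, OF _ bij_imp_bij_inv])
  then show ?thesis
    using \<open>bij f\<close> by (simp add: inv_inv_eq)
qed

end
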